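(* Let $a, b, c \in \mathbb{Z}$ with $c$ nonnegative and square-free. If there exist $n$ roots of unity $\theta_1, \ldots, \theta_n$ such that $\sum_{i=1}^n \theta_i = a + b\sqrt{c}$, then $n \geq |b|\,\phi(2c)$.
   Context: $\phi$ denotes the Euler totient function. The roots of unity $\theta_i$ are complex numbers and need not be distinct.
   Formalization: The formal theorem additionally assumes c ≠ 1, since for c = 1 the claim fails (e.g. 1 = -4 + 5√1 with n = 1, but |b|φ(2) = 5), as b is not determined by a + b√1. *)

theory Defs
  imports "HOL-Analysis.Analysis" "HOL-Computational_Algebra.Squarefree" "HOL-Number_Theory.Totient"
begin

definition root_of_unity :: "complex \<Rightarrow> bool" where
  "root_of_unity z \<longleftrightarrow> (\<exists>k::nat. k > 0 \<and> z ^ k = 1)"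

end

theory Submission
  imports Defs "HOL-Number_Theory.Euler_Criterion" "HOL-Computational_Algebra.Polynomial"
begin

text \<open>Let \<open>p\<close> be an odd prime dividing \<open>c\<close>. Up to a fourth root of unity, the square root of \<open>c\<close> is the
  product of the quadratic Gauss sums \<open>G\<^sub>p\<close> over these \<open>p\<close>, times \<open>sqrt 2\<close> if \<open>c\<close> is even. Apply to
  \<open>\<theta>\<^sub>1 + \<dots> + \<theta>\<^sub>n = a + b sqrt c\<close> all automorphisms of the cyclotomic field that fix the roots of unity
  of order prime to \<open>p\<close>, weighted by the Legendre symbol, and add up. This kills \<open>a\<close>, multiplies
  \<open>G\<^sub>p\<close> by \<open>p - 1\<close> (up to a common factor), and turns each root of unity into \<open>0\<close> or \<open>G\<^sub>p\<close> times a root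
  of unity. After cancelling \<open>G\<^sub>p\<close>, again a sum of at most \<open>n\<close> roots of unity remains. Iterate over
  the odd \<open>p\<close>, treat \<open>sqrt 2\<close> in the same way with the character modulo 8, and finally take absolute
  values.\<close>

hide_const (open) Module.smult up_ring.monom up_ring.coeff

section \<open>Irreducibility of cyclotomic polynomials\<close>

abbreviation int_poly_eval :: "int poly \<Rightarrow> complex \<Rightarrow> complex" where
  "int_poly_eval P z \<equiv> poly (map_poly of_int P) z"

lemma int_poly_eval_pCons: "int_poly_eval (pCons a P) z = of_int a + z * int_poly_eval P z"
  by (simp add: map_poly_pCons)

lemma int_poly_eval_add: "int_poly_eval (P + Q) z = int_poly_eval P z + int_poly_eval Q z"
  by (induction P Q rule: poly_induct2) (simp_all add: int_poly_eval_pCons algebra_simps)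

lemma int_poly_eval_smult: "int_poly_eval (smult c P) z = of_int c * int_poly_eval P z"
  by (induction P) (simp_all add: int_poly_eval_pCons algebra_simps)

lemma int_poly_eval_diff: "int_poly_eval (P - Q) z = int_poly_eval P z - int_poly_eval Q z"
  using int_poly_eval_add[of "P - Q" Q z] by simp

lemma int_poly_eval_mult: "int_poly_eval (P * Q) z = int_poly_eval P z * int_poly_eval Q z"
  by (induction P)
    (simp_all add: int_poly_eval_pCons int_poly_eval_add int_poly_eval_smult algebra_simps)

lemma int_poly_eval_power: "int_poly_eval (P ^ n) z = int_poly_eval P z ^ n"
  by (induction n) (simp_all add: int_poly_eval_mult)

lemma int_poly_eval_monom: "int_poly_eval (monom c n) z = of_int c * z ^ n"
  by (simp add: map_poly_monom poly_monom)

lemma int_poly_eval_pcompose_monom: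
  "int_poly_eval (pcompose P (monom 1 k)) z = int_poly_eval P (z ^ k)"
  by (induction P)
    (simp_all add: pcompose_pCons int_poly_eval_pCons int_poly_eval_add int_poly_eval_mult
      int_poly_eval_monom)

text \<open>Take the primitive part of an annihilating polynomial of least degree. Pseudo-division
  shows that it divides a constant multiple of \<open>h\<close>, and Gauss's lemma removes the
  constant.\<close>

lemma int_minimal_poly_exists:
  assumes "g \<noteq> 0" and "int_poly_eval g z = 0"
  shows "\<exists>f. f \<noteq> 0 \<and> int_poly_eval f z = 0 \<and> (\<forall>h. int_poly_eval h z = 0 \<longrightarrow> f dvd h)"
proof -
  define S where "S = {h. h \<noteq> 0 \<and> int_poly_eval h z = 0}"
  have "\<exists>h. h \<in> S" using assms unfolding S_def by auto
  then obtain f0 where f0: "f0 \<in> S" and min: "\<And>h. h \<in> S \<Longrightarrow> degree f0 \<le> degree h"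
    using ex_has_least_nat[of "\<lambda>h. h \<in> S" _ degree] by auto
  define f where "f = primitive_part f0"
  have f0f: "f0 = smult (content f0) f"
    by (simp add: f_def)
  have c0: "content f0 \<noteq> 0" and f0n: "f0 \<noteq> 0"
    using f0 by (auto simp: S_def)
  have fn: "f \<noteq> 0" and cf: "content f = 1"
    using f0n by (auto simp: f_def)
  have "of_int (content f0) * int_poly_eval f z = 0"
    using f0 by (subst int_poly_eval_smult[symmetric], subst f0f[symmetric]) (simp add: S_def)
  hence fz: "int_poly_eval f z = 0" using c0 by simp
  have deg: "degree f = degree f0" using c0 by (subst f0f) simp
  have "f dvd h" if h: "int_poly_eval h z = 0" for h
  proof -
    obtain a q where a: "a \<noteq> 0" and aq: "smult a h = f * q + pseudo_mod h f"
      using pseudo_mod(1)[OF fn, of h] by blast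
    have "int_poly_eval (pseudo_mod h f) z = int_poly_eval (smult a h - f * q) z"
      using aq by simp
    also have "\<dots> = 0"
      by (simp add: int_poly_eval_diff int_poly_eval_smult int_poly_eval_mult h fz)
    finally have "pseudo_mod h f = 0"
      using pseudo_mod(2)[OF fn, of h] min[of "pseudo_mod h f"] deg unfolding S_def
      by (metis (mono_tags, lifting) leD mem_Collect_eq)
    hence eq: "smult a h = f * q" using aq by simp
    \<comment> \<open>Gauss's lemma: \<open>f\<close> has content 1, so \<open>a\<close> divides the
      content of \<open>q\<close> and can be cancelled.\<close>
    have "content q = content (smult a h)"
      by (simp only: eq content_mult cf mult_1)
    hence "a dvd content q" by simp
    hence "[:a:] dvd q" by (simp add: const_poly_dvd_iff_dvd_content)
    then obtain q' where "q = smult a q'" by (auto elim!: dvdE)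
    hence "smult a h = smult a (f * q')" using eq by simp
    hence "smult a (h - f * q') = 0" by (simp add: smult_diff_right)
    hence "h = f * q'" using a by simp
    thus ?thesis by simp
  qed
  thus ?thesis using fn fz by blast
qed

text \<open>The powers of \<open>z\<close> below the degree of its minimal polynomial form a basis of
  \<open>\<int>[z]\<close>, so an integer dividing a nonzero element divides its coordinates.\<close>

lemma unity_ring_divisor_bounded:
  fixes z :: complex
  assumes "z ^ N = 1" and "N > 0" and "int_poly_eval P z \<noteq> 0"
  shows "\<exists>B. \<forall>p Q. int_poly_eval P z = of_nat p * int_poly_eval Q z \<longrightarrow> p \<le> B"
proof -
  define X where "X = monom (1::int) N - 1"
  have X0: "X \<noteq> 0"
  proof
    assume "X = 0"
    hence "coeff X N = 0" by simp
    thus False using assms(2) by (simp add: X_def)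
  qed
  have Xz: "int_poly_eval X z = 0"
    using assms(1) by (simp add: X_def int_poly_eval_diff int_poly_eval_monom)
  obtain f where f: "f \<noteq> 0" "int_poly_eval f z = 0"
    and f_dvd: "\<And>h. int_poly_eval h z = 0 \<Longrightarrow> f dvd h"
    using int_minimal_poly_exists[OF X0 Xz] by blast
  have "f dvd X" using f_dvd Xz by blast
  then obtain g where g: "X = f * g" by (elim dvdE)
  \<comment> \<open>\<open>f\<close> divides the monic polynomial \<open>X\<close>, so its leading
    coefficient is 1 or -1; this makes division by \<open>f\<close> possible over the
    integers.\<close>
  have "lead_coeff X = 1"
  proof -
    have "degree X = N"
      unfolding X_def using assms(2)
      by (intro order.antisym degree_le le_degree) (auto simp: coeff_1)
    thus ?thesis using assms(2) by (simp add: X_def)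
  qed
  hence "lead_coeff f * lead_coeff g = 1" by (simp add: g lead_coeff_mult)
  hence lf: "lead_coeff f * lead_coeff f = 1"
    by (auto simp: zmult_eq_1_iff)
  define d where "d = degree f"
  have red: "\<exists>R. int_poly_eval R z = int_poly_eval Q z \<and> (R = 0 \<or> degree R < d)" for Q
  proof -
    obtain q r where qr: "pseudo_divmod Q f = (q, r)" by fastforce
    define n where "n = Suc (degree Q) - degree f"
    have 1: "smult (lead_coeff f ^ n) Q = f * q + r" and 2: "r = 0 \<or> degree r < d"
      using pseudo_divmod[OF f(1) qr] by (simp_all add: n_def d_def)
    define R where "R = smult (lead_coeff f ^ n) r"
    \<comment> \<open>The leading coefficient is its own inverse, so a second factor
      \<open>lead_coeff f ^ n\<close> undoes the scaling of pseudo-division.\<close>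
    have "lead_coeff f ^ n * lead_coeff f ^ n = 1"
      using lf by (simp flip: power_mult_distrib)
    hence "Q = smult (lead_coeff f ^ n) (f * q) + R"
      using arg_cong[OF 1, of "smult (lead_coeff f ^ n)"]
      by (simp add: R_def smult_add_right)
    hence "int_poly_eval Q z = int_poly_eval R z"
      by (simp add: int_poly_eval_add int_poly_eval_mult int_poly_eval_smult f(2))
    moreover have "R = 0 \<or> degree R < d" using 2 by (auto simp: R_def)
    ultimately show ?thesis by metis
  qed
  have small_zero: "h = 0" if "int_poly_eval h z = 0" "h = 0 \<or> degree h < d" for h
    using f_dvd[OF that(1)] that(2) by (metis dvd_imp_degree_le d_def leD)
  obtain R where R: "int_poly_eval R z = int_poly_eval P z" "R = 0 \<or> degree R < d"
    using red by blast
  have R0: "R \<noteq> 0" using assms(3) R(1) by auto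
  \<comment> \<open>Representatives of degree below \<open>d\<close> are unique, so the reduced
    \<open>R\<close> is \<open>p\<close> times a polynomial and \<open>p\<close> divides its leading
    coefficient.\<close>
  have "p \<le> nat \<bar>lead_coeff R\<bar>" if p: "int_poly_eval P z = of_nat p * int_poly_eval Q z" for p Q
  proof -
    obtain T where T: "int_poly_eval T z = int_poly_eval Q z" "T = 0 \<or> degree T < d"
      using red by blast
    have "int_poly_eval (R - smult (int p) T) z = 0"
      using p R(1) T(1) by (simp add: int_poly_eval_diff int_poly_eval_smult)
    moreover have "R - smult (int p) T = 0 \<or> degree (R - smult (int p) T) < d"
      using R T degree_diff_less[of R d "smult (int p) T"] R0
      by (cases "T = 0") auto
    ultimately have "R = smult (int p) T" using small_zero by fastforce
    hence "int p dvd lead_coeff R" by simp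
    thus ?thesis using R0 dvd_imp_le_int[of "lead_coeff R" "int p"] by simp
  qed
  thus ?thesis by blast
qed

section \<open>The Frobenius congruence for integer polynomials\<close>

text \<open>The inner binomial coefficients are divisible by \<open>p\<close>. The general ring
  allows use for both integers and integer polynomials.\<close>

lemma prime_power_add_remainder:
  fixes x y :: "'a :: comm_ring_1"
  assumes "prime p"
  shows "\<exists>w. (x + y) ^ p = x ^ p + y ^ p + of_nat p * w"
proof -
  define w where "w = (\<Sum>k\<in>{0<..<p}. of_nat ((p choose k) div p) * x ^ k * y ^ (p - k))"
  have p: "p > 0" using assms prime_gt_0_nat by blast
  have "(x + y) ^ p = (\<Sum>k\<le>p. of_nat (p choose k) * x ^ k * y ^ (p - k))"
    by (rule binomial_ring)
  also have "{..p} = insert 0 (insert p {0<..<p})"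
    using p by auto
  also have "(\<Sum>k\<in>\<dots>. of_nat (p choose k) * x ^ k * y ^ (p - k))
      = x ^ p + y ^ p + (\<Sum>k\<in>{0<..<p}. of_nat (p choose k) * x ^ k * y ^ (p - k))"
    using p by simp
  also have "(\<Sum>k\<in>{0<..<p}. of_nat (p choose k) * x ^ k * y ^ (p - k)) = of_nat p * w"
    unfolding w_def sum_distrib_left
  proof (intro sum.cong refl)
    fix k assume k: "k \<in> {0<..<p}"
    have "p dvd (p choose k)"
      by (rule dvd_choose_prime) (use k assms in auto)
    hence "of_nat (p choose k) = (of_nat p * of_nat ((p choose k) div p) :: 'a)"
      by (metis dvd_mult_div_cancel of_nat_mult)
    thus "of_nat (p choose k) * x ^ k * y ^ (p - k)
        = of_nat p * (of_nat ((p choose k) div p) * x ^ k * y ^ (p - k))"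
      by (simp add: mult.assoc)
  qed
  finally show ?thesis by blast
qed

text \<open>Fermat's little theorem, by induction on naturals through the binomial expansion; other
  integers follow by reduction modulo \<open>p\<close>.\<close>

lemma int_prime_power_remainder:
  fixes a :: int
  assumes "prime p"
  shows "\<exists>w. a ^ p = a + int p * w"
proof -
  have nat: "[int n ^ p = int n] (mod int p)" for n
  proof (induction n)
    case 0
    have "p > 0" using assms prime_gt_0_nat by blast
    thus ?case by (simp add: zero_power)
  next
    case (Suc n)
    obtain w where w: "(int n + 1) ^ p = int n ^ p + 1 ^ p + of_nat p * w"
      using prime_power_add_remainder[OF assms] by blast
    hence "int (Suc n) ^ p - int (Suc n) = (int n ^ p - int n) + int p * w"
      by (simp add: algebra_simps)
    with Suc show ?case unfolding cong_iff_dvd_diff by (metis dvd_add dvd_triv_left)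
  qed
  have "p > 0" using assms prime_gt_0_nat by blast
  hence "[a = int (nat (a mod int p))] (mod int p)" by simp
  hence "[a ^ p = a] (mod int p)"
    using nat[of "nat (a mod int p)"] by (meson cong_pow cong_sym cong_trans)
  hence "int p dvd a ^ p - a" by (simp add: cong_iff_dvd_diff)
  then obtain w where "a ^ p - a = int p * w" by (elim dvdE)
  hence "a ^ p = a + int p * w" by simp
  thus ?thesis by blast
qed

text \<open>Modulo \<open>p\<close>, the \<open>p\<close>-th power is additive and fixes the
  coefficients, so only the variable is raised to the power \<open>p\<close>.\<close>

lemma int_poly_prime_power:
  assumes "prime p"
  shows "\<exists>g. P ^ p = pcompose P (monom 1 p) + smult (int p) g"
proof (induction P)
  case 0
  show ?case using assms by (simp add: prime_gt_0_nat exI[of _ 0])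
next
  case (pCons a P)
  obtain g where g: "P ^ p = pcompose P (monom 1 p) + smult (int p) g" using pCons by blast
  have "pCons a P = [:a:] + monom 1 1 * P"
    by (simp add: monom_Suc)
  then obtain w where w: "pCons a P ^ p = [:a:] ^ p + (monom 1 1 * P) ^ p + of_nat p * w"
    using prime_power_add_remainder[OF assms] by metis
  obtain v where v: "a ^ p = a + int p * v" using int_prime_power_remainder[OF assms] by blast
  have "[:a:] ^ p = [:a:] + smult (int p) [:v:]"
    by (simp add: v poly_const_pow)
  moreover have "(monom 1 1 * P) ^ p = monom 1 p * (pcompose P (monom 1 p) + smult (int p) g)"
    by (simp add: power_mult_distrib g monom_power)
  ultimately have "pCons a P ^ p = pcompose (pCons a P) (monom 1 p)
      + smult (int p) ([:v:] + monom 1 p * g + w)"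
    unfolding w by (simp add: pcompose_pCons algebra_simps smult_add_right of_nat_poly)
  thus ?case by blast
qed

lemma power_mod_of_power_eq_1:
  fixes z :: "'a :: monoid_mult"
  assumes "z ^ n = 1"
  shows "z ^ (j mod n) = z ^ j"
proof -
  have "z ^ j = z ^ (n * (j div n) + j mod n)" by simp
  also have "\<dots> = z ^ (j mod n)" unfolding power_add power_mult assms by simp
  finally show ?thesis by simp
qed

text \<open>Landau's argument: if \<open>P(z) = 0\<close>, then \<open>P(z ^ p)\<close> is divisible by the prime \<open>p\<close>; since
  \<open>P\<close> takes finitely many values on the powers of \<open>z\<close>, it vanishes at \<open>z ^ p\<close> for all large
  primes \<open>p\<close>. Finally, every \<open>k\<close> coprime to \<open>N\<close> is congruent modulo \<open>N\<close> to a product of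
  large primes.\<close>

lemma int_poly_eval_coprime_power:
  fixes z :: complex
  assumes "z ^ N = 1" and "N > 0" and "int_poly_eval P z = 0" and "coprime k N"
  shows "int_poly_eval P (z ^ k) = 0"
proof -
  have zmod: "z ^ (j mod N) = z ^ j" for j
    by (rule power_mod_of_power_eq_1[OF assms(1)])
  have "\<exists>B. \<forall>p Q. int_poly_eval P (z ^ j) \<noteq> 0 \<longrightarrow>
      int_poly_eval P (z ^ j) = of_nat p * int_poly_eval Q z \<longrightarrow> p \<le> B" for j
    using unity_ring_divisor_bounded[OF assms(1,2), of "pcompose P (monom 1 j)"]
    unfolding int_poly_eval_pcompose_monom by blast
  then obtain B where B: "\<And>j p Q. int_poly_eval P (z ^ j) \<noteq> 0 \<Longrightarrow>
      int_poly_eval P (z ^ j) = of_nat p * int_poly_eval Q z \<Longrightarrow> p \<le> B j"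
    by metis
  \<comment> \<open>\<open>z ^ j\<close> depends only on \<open>j mod N\<close>, so finitely many
    bounds combine into one that serves every exponent.\<close>
  define M where "M = (\<Sum>j<N. B j)"
  have M: "p \<le> M" if "int_poly_eval P (z ^ j) \<noteq> 0"
    "int_poly_eval P (z ^ j) = of_nat p * int_poly_eval Q z" for j p Q
  proof -
    have "p \<le> B (j mod N)" using B[of "j mod N" p Q] that by (simp add: zmod)
    also have "\<dots> \<le> M" unfolding M_def using assms(2) by (intro member_le_sum) auto
    finally show ?thesis .
  qed
  have step: "int_poly_eval P (z ^ (p * j)) = 0"
    if p: "prime p" "p > M" and j: "int_poly_eval P (z ^ j) = 0" for p j
  proof (rule ccontr)
    assume nz: "int_poly_eval P (z ^ (p * j)) \<noteq> 0"
    obtain g where "P ^ p = pcompose P (monom 1 p) + smult (int p) g"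
      using int_poly_prime_power[OF p(1)] by blast
    hence "int_poly_eval (P ^ p) (z ^ j)
        = int_poly_eval P ((z ^ j) ^ p) + of_nat p * int_poly_eval g (z ^ j)"
      by (simp add: int_poly_eval_add int_poly_eval_smult int_poly_eval_pcompose_monom)
    moreover have "int_poly_eval (P ^ p) (z ^ j) = 0"
      using p(1) j by (simp add: int_poly_eval_power prime_gt_0_nat)
    ultimately have "int_poly_eval P (z ^ (p * j))
        = of_nat p * int_poly_eval (smult (-1) (pcompose g (monom 1 j))) z"
      unfolding int_poly_eval_smult int_poly_eval_pcompose_monom
      by (simp add: power_mult[symmetric] mult.commute eq_neg_iff_add_eq_0)
    from M[OF nz this] p(2) show False by simp
  qed
  have large: "int_poly_eval P (z ^ j) = 0"
    if "j \<noteq> 0" "\<And>p. prime p \<Longrightarrow> p dvd j \<Longrightarrow> p > M" for j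
    using that
  proof (induction j rule: prime_divisors_induct)
    case (factor p x)
    show ?case
      by (rule step) (use factor in auto)
  qed (use assms(3) in auto)
  \<comment> \<open>Adding \<open>N * T\<close> to \<open>k\<close> removes all primes up to
    \<open>M\<close>: one not dividing \<open>k\<close> divides \<open>T\<close>, while one dividing
    \<open>k\<close> divides neither \<open>N\<close> nor \<open>T\<close>.\<close>
  define T where "T = (\<Prod>p | prime p \<and> p \<le> M \<and> \<not> p dvd k. p)"
  have fin: "finite {p. prime p \<and> p \<le> M \<and> \<not> p dvd k}"
    by (rule finite_subset[of _ "{..M}"]) auto
  define k' where "k' = k + N * T"
  have T: "T > 0" unfolding T_def by (intro prod_pos) (auto simp: prime_gt_0_nat)
  have "int_poly_eval P (z ^ k') = 0"
  proof (rule large)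
    show "k' \<noteq> 0" using T assms(2) by (simp add: k'_def)
    fix p :: nat assume p: "prime p" "p dvd k'"
    show "p > M"
    proof (rule ccontr)
      assume "\<not> p > M"
      hence le: "p \<le> M" by simp
      show False
      proof (cases "p dvd k")
        case False
        hence "p dvd T" unfolding T_def by (intro dvd_prodI fin) (use p le in auto)
        hence "p dvd k" using p(2) by (simp add: k'_def dvd_add_left_iff)
        thus False using False by simp
      next
        case True
        hence "p dvd N * T" using p(2) by (simp add: k'_def dvd_add_right_iff)
        moreover have "\<not> p dvd N"
          using True assms(4) p(1) coprime_common_divisor_nat not_prime_1 by blast
        ultimately have "p dvd T" using p(1) by (simp add: prime_dvd_mult_iff)
        then obtain r where "prime r" "\<not> r dvd k" "p dvd r"
          unfolding T_def using p(1) fin by (auto simp: prime_dvd_prod_iff)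
        thus False using p(1) True primes_dvd_imp_eq by blast
      qed
    qed
  qed
  moreover have "z ^ k' = z ^ k" by (simp add: k'_def power_add power_mult assms(1))
  ultimately show ?thesis by simp
qed

section \<open>Conjugates of cyclotomic integers\<close>

definition unity :: "nat \<Rightarrow> complex" where
  "unity n = cis (2 * pi / real n)"

lemma unity_power_self: "n > 0 \<Longrightarrow> unity n ^ n = 1"
  by (simp add: unity_def Complex.DeMoivre)

lemma unity_mult_power: "a > 0 \<Longrightarrow> unity (a * b) ^ a = unity b"
  by (simp add: unity_def Complex.DeMoivre)

lemma power_eq_1_imp_unity_power:
  assumes "z ^ n = 1" and "n > 0"
  obtains j where "j < n" and "z = unity n ^ j"
proof -
  have "z \<in> (\<lambda>k. cis (2 * pi * real k / real n)) ` {..<n}"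
    using assms Complex.bij_betw_roots_unity[OF assms(2)] by (simp add: bij_betw_def)
  then obtain j where "j < n" "z = cis (2 * pi * real j / real n)" by auto
  thus ?thesis using that[of j] by (simp add: unity_def Complex.DeMoivre mult_ac)
qed

text \<open>\<open>conjugate_pair N k\<close> is the graph of the automorphism \<open>\<zeta> \<mapsto> \<zeta> ^ k\<close> of the ring of
  integers \<open>\<int>[\<zeta>]\<close>, where \<open>\<zeta>\<close> is the standard primitive \<open>N\<close>-th root of unity.\<close>

definition conjugate_pair :: "nat \<Rightarrow> nat \<Rightarrow> complex \<Rightarrow> complex \<Rightarrow> bool" where
  "conjugate_pair N k z z' \<longleftrightarrow>
     (\<exists>P. z = int_poly_eval P (unity N) \<and> z' = int_poly_eval P (unity N ^ k))"

text \<open>This is where irreducibility enters: the difference of two representing polynomials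
  vanishes at the primitive root, hence also at its \<open>k\<close>-th power.\<close>

lemma conjugate_pair_unique:
  assumes "conjugate_pair N k z z1" and "conjugate_pair N k z z2" and "N > 0" and "coprime k N"
  shows "z1 = z2"
proof -
  obtain P where P: "z = int_poly_eval P (unity N)" "z1 = int_poly_eval P (unity N ^ k)"
    using assms(1) by (auto simp: conjugate_pair_def)
  obtain Q where Q: "z = int_poly_eval Q (unity N)" "z2 = int_poly_eval Q (unity N ^ k)"
    using assms(2) by (auto simp: conjugate_pair_def)
  have "int_poly_eval (P - Q) (unity N ^ k) = 0"
    using P Q assms
    by (intro int_poly_eval_coprime_power[where N = N])
      (simp_all add: unity_power_self int_poly_eval_diff)
  thus ?thesis using P Q by (simp add: int_poly_eval_diff)
qed

lemma conjugate_pair_of_int: "conjugate_pair N k (of_int a) (of_int a)"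
  unfolding conjugate_pair_def by (rule exI[of _ "[:a:]"]) (simp add: int_poly_eval_pCons)

lemma conjugate_pair_add:
  "conjugate_pair N k a a' \<Longrightarrow> conjugate_pair N k b b' \<Longrightarrow> conjugate_pair N k (a + b) (a' + b')"
  unfolding conjugate_pair_def by (metis int_poly_eval_add)

lemma conjugate_pair_mult:
  "conjugate_pair N k a a' \<Longrightarrow> conjugate_pair N k b b' \<Longrightarrow> conjugate_pair N k (a * b) (a' * b')"
  unfolding conjugate_pair_def by (metis int_poly_eval_mult)

lemma conjugate_pair_sum:
  "(\<And>i. i \<in> I \<Longrightarrow> conjugate_pair N k (f i) (g i)) \<Longrightarrow>
    conjugate_pair N k (\<Sum>i\<in>I. f i) (\<Sum>i\<in>I. g i)"
  using conjugate_pair_of_int[of N k 0]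
  by (induction I rule: infinite_finite_induct) (auto intro: conjugate_pair_add)

lemma conjugate_pair_root:
  assumes "z ^ N = 1" and "N > 0"
  shows "conjugate_pair N k z (z ^ k)"
proof -
  obtain j where "z = unity N ^ j" using power_eq_1_imp_unity_power[OF assms] by blast
  thus ?thesis unfolding conjugate_pair_def
    by (intro exI[of _ "monom 1 j"])
      (simp add: int_poly_eval_monom power_mult[symmetric] mult.commute)
qed

section \<open>Rings of cyclotomic integers of varying level\<close>

definition cyclotomic_integers :: "nat \<Rightarrow> complex set" where
  "cyclotomic_integers m = range (\<lambda>P. int_poly_eval P (unity m))"

text \<open>Rewrite the polynomial in \<open>unity m\<close> as one in a power of
  \<open>unity N\<close>; raising to the power \<open>k\<close> leaves \<open>unity m\<close>
  unchanged.\<close>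

lemma conjugate_pair_fixed:
  assumes "w \<in> cyclotomic_integers m" and "m dvd N" and "N > 0" and "[k = 1] (mod m)"
  shows "conjugate_pair N k w w"
proof -
  obtain P where P: "w = int_poly_eval P (unity m)"
    using assms(1) by (auto simp: cyclotomic_integers_def)
  obtain d where d: "N = m * d" using assms(2) by (elim dvdE)
  hence m0: "m > 0" "d > 0" using assms(3) by auto
  have u: "unity N ^ d = unity m"
    using unity_mult_power[of d m] m0 by (simp add: d mult.commute)
  have "unity m ^ k = unity m ^ (k mod m)"
    using unity_power_self[OF m0(1)] by (simp add: power_mod_of_power_eq_1)
  also have "\<dots> = unity m ^ (1 mod m)"
    using assms(4) by (simp add: cong_def)
  also have "\<dots> = unity m"
    using unity_power_self[OF m0(1)] power_mod_of_power_eq_1[of "unity m" m 1] by simp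
  finally have "(unity N ^ k) ^ d = unity m"
    by (metis u power_mult mult.commute)
  thus ?thesis unfolding conjugate_pair_def
    by (intro exI[of _ "pcompose P (monom 1 d)"]) (simp add: int_poly_eval_pcompose_monom u P)
qed

lemma cyclotomic_integers_of_int: "of_int a \<in> cyclotomic_integers m"
  unfolding cyclotomic_integers_def by (rule range_eqI[of _ _ "[:a:]"]) (simp add: int_poly_eval_pCons)

lemma cyclotomic_integers_mult:
  "a \<in> cyclotomic_integers m \<Longrightarrow> b \<in> cyclotomic_integers m \<Longrightarrow> a * b \<in> cyclotomic_integers m"
  unfolding cyclotomic_integers_def by (auto simp: int_poly_eval_mult[symmetric])

lemma cyclotomic_integers_add:
  "a \<in> cyclotomic_integers m \<Longrightarrow> b \<in> cyclotomic_integers m \<Longrightarrow> a + b \<in> cyclotomic_integers m"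
  unfolding cyclotomic_integers_def by (auto simp: int_poly_eval_add[symmetric])

lemma cyclotomic_integers_sum:
  "(\<And>i. i \<in> I \<Longrightarrow> f i \<in> cyclotomic_integers m) \<Longrightarrow> (\<Sum>i\<in>I. f i) \<in> cyclotomic_integers m"
  using cyclotomic_integers_of_int[of 0 m]
  by (induction I rule: infinite_finite_induct) (auto intro: cyclotomic_integers_add)

lemma cyclotomic_integers_root:
  assumes "z ^ m = 1" and "m > 0"
  shows "z \<in> cyclotomic_integers m"
proof -
  obtain j where "z = unity m ^ j" using power_eq_1_imp_unity_power[OF assms] by blast
  thus ?thesis unfolding cyclotomic_integers_def
    by (intro range_eqI[of _ _ "monom 1 j"]) (simp add: int_poly_eval_monom)
qed

text \<open>The case \<open>k = 1\<close> of the previous fact on fixed elements, whose witness is a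
  polynomial in \<open>unity N\<close>.\<close>

lemma cyclotomic_integers_mono:
  assumes "m dvd N" and "N > 0"
  shows "cyclotomic_integers m \<subseteq> cyclotomic_integers N"
  using conjugate_pair_fixed[OF _ assms, of _ 1]
  by (auto simp: conjugate_pair_def cyclotomic_integers_def)

section \<open>Twisting by a primitive real character\<close>

text \<open>Zero summands are allowed because a twist may send a root of unity to zero; the length
  \<open>n\<close> then stays constant.\<close>

definition root_sum :: "nat \<Rightarrow> complex \<Rightarrow> bool" where
  "root_sum n z \<longleftrightarrow> (\<exists>\<theta>. (\<forall>i<n. \<theta> i = 0 \<or> root_of_unity (\<theta> i)) \<and> z = (\<Sum>i<n. \<theta> i))"

lemma root_of_unity_mult:
  assumes "root_of_unity a" and "root_of_unity b"
  shows "root_of_unity (a * b)"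
proof -
  obtain j k where "j > 0" "a ^ j = 1" "k > 0" "b ^ k = 1"
    using assms by (auto simp: root_of_unity_def)
  hence "j * k > 0" "(a * b) ^ (j * k) = 1"
    by (simp_all add: power_mult_distrib power_mult)
       (metis mult.commute power_mult power_one)
  thus ?thesis unfolding root_of_unity_def by blast
qed

lemma root_of_unity_norm: "root_of_unity z \<Longrightarrow> norm z = 1"
  by (auto simp: root_of_unity_def dest: power_eq_1_iff)

lemma root_sum_norm_le:
  assumes "root_sum n z"
  shows "norm z \<le> real n"
proof -
  obtain \<theta> where \<theta>: "\<forall>i<n. \<theta> i = 0 \<or> root_of_unity (\<theta> i)" "z = (\<Sum>i<n. \<theta> i)"
    using assms by (auto simp: root_sum_def)
  have "norm z \<le> (\<Sum>i<n. 1)" unfolding \<theta>(2)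
    using \<theta>(1) root_of_unity_norm by (intro sum_norm_le) fastforce
  thus ?thesis by simp
qed

lemma root_sum_mult:
  assumes "root_of_unity u" and "root_sum n z"
  shows "root_sum n (u * z)"
proof -
  obtain \<theta> where \<theta>: "\<forall>i<n. \<theta> i = 0 \<or> root_of_unity (\<theta> i)" "z = (\<Sum>i<n. \<theta> i)"
    using assms by (auto simp: root_sum_def)
  show ?thesis unfolding root_sum_def
    by (rule exI[of _ "\<lambda>i. u * \<theta> i"])
      (use \<theta> assms(1) root_of_unity_mult in \<open>auto simp: sum_distrib_left\<close>)
qed

lemma root_sum_double:
  assumes "root_sum n z"
  shows "root_sum (2 * n) (2 * z)"
proof -
  obtain \<theta> where \<theta>: "\<forall>i<n. \<theta> i = 0 \<or> root_of_unity (\<theta> i)" "z = (\<Sum>i<n. \<theta> i)"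
    using assms by (auto simp: root_sum_def)
  have "(\<Sum>i<2 * n. \<theta> (i div 2)) = 2 * (\<Sum>i<n. \<theta> i)"
    by (induction n) (simp_all add: algebra_simps)
  thus ?thesis unfolding root_sum_def
    by (intro exI[of _ "\<lambda>i. \<theta> (i div 2)"]) (use \<theta> in auto)
qed

section \<open>Gauss sums and real characters\<close>

text \<open>The frequency \<open>r\<close> is a parameter because conjugation by \<open>k\<close>
  turns frequency 1 into frequency \<open>k\<close>.\<close>

definition gauss_sum :: "(nat \<Rightarrow> int) \<Rightarrow> nat \<Rightarrow> nat \<Rightarrow> complex" where
  "gauss_sum \<psi> q r = (\<Sum>y<q. of_int (\<psi> y) * unity q ^ (r * y))"

lemma sum_shift_period:
  fixes f :: "nat \<Rightarrow> 'a :: ab_group_add"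
  assumes "f q = f 0"
  shows "(\<Sum>t<q. f (Suc t)) = (\<Sum>t<q. f t)"
proof -
  have "f 0 + (\<Sum>t<q. f (Suc t)) = (\<Sum>t<q. f t) + f q"
    using sum.lessThan_Suc_shift[of f q] sum.lessThan_Suc[of f q] by simp
  thus ?thesis using assms by simp
qed

lemma sum_lessThan_mult:
  fixes f :: "nat \<Rightarrow> 'a :: comm_monoid_add"
  shows "(\<Sum>t<q * L. f t) = (\<Sum>s<L. \<Sum>y<q. f (y + q * s))"
proof (induction L)
  case (Suc L)
  have "(\<Sum>t<a + b. f t) = (\<Sum>t<a. f t) + (\<Sum>y<b. f (y + a))" for a b
    by (induction b) (simp_all add: add_ac)
  from this[of "q * L" q] Suc show ?case by (simp add: add.commute)
qed simp

lemma sum_power_root_of_unity: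
  fixes z :: complex
  assumes "z ^ n = 1"
  shows "(\<Sum>k<n. z ^ k) = (if z = 1 then of_nat n else 0)"
  using assms geometric_sum[of z n] by simp

text \<open>Common ground of the Legendre symbol and the character modulo 8.
  \<open>separable\<close> stands in for multiplicativity and primitivity: with
  \<open>square\<close> it makes Gauss sums of frequency not coprime to \<open>q\<close>
  vanish.\<close>

locale primitive_real_character =
  fixes \<psi> :: "nat \<Rightarrow> int" and l s q :: nat
  assumes prime_l: "prime l" and s_pos: "s > 0" and q_def: "q = l ^ s"
    and periodic: "\<psi> (x mod q) = \<psi> x"
    and square: "\<psi> x * \<psi> x = (if coprime x q then 1 else 0)"
    and separable: "gauss_sum \<psi> q r = of_int (\<psi> r) * gauss_sum \<psi> q 1"
    and gauss_sum_nonzero: "gauss_sum \<psi> q 1 \<noteq> 0"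
begin

lemma l_gt_1: "l > 1"
  using prime_l prime_gt_1_nat by blast

lemma q_gt_1: "q > 1"
  using one_less_power[OF l_gt_1 s_pos] q_def by simp

lemma character_eq_0: "\<not> coprime x q \<Longrightarrow> \<psi> x = 0"
  using square[of x] by simp

lemma character_values: "\<psi> x \<in> {-1, 0, 1}"
proof -
  have "\<psi> x * \<psi> x = 0 \<or> \<psi> x * \<psi> x = 1" using square[of x] by simp
  thus ?thesis by (auto simp: zmult_eq_1_iff)
qed

lemma character_add_period: "\<psi> (x + q * y) = \<psi> x"
  using periodic[of "x + q * y"] periodic[of x] by simp

text \<open>This is the Gauss sum of frequency 0, by \<open>separable\<close> a multiple of
  \<open>\<psi> 0 = 0\<close>.\<close>

lemma character_sum: "(\<Sum>y<q. \<psi> y) = 0"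
proof -
  have "of_int (\<Sum>y<q. \<psi> y) = gauss_sum \<psi> q 0"
    by (simp add: gauss_sum_def)
  also have "\<dots> = 0"
    using separable[of 0] character_eq_0[of 0] q_gt_1 by simp
  finally show ?thesis by (simp only: of_int_eq_0_iff)
qed

lemma character_square_sum: "(\<Sum>y<q. \<psi> y * \<psi> y) = int (totient q)"
proof -
  have "(\<Sum>y<q. \<psi> y * \<psi> y) = (\<Sum>y<q. if coprime y q then 1 else 0)"
    by (simp add: square)
  also have "\<dots> = int (card {y. y < q \<and> coprime y q})"
    by (simp add: sum.If_cases Int_def lessThan_def)
  also have "{y. y < q \<and> coprime y q} = totatives q"
  proof (intro equalityI subsetI)
    fix y assume "y \<in> {y. y < q \<and> coprime y q}"
    thus "y \<in> totatives q" using q_gt_1 by (cases "y = 0") (auto simp: in_totatives_iff)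
  next
    fix y assume "y \<in> totatives q"
    thus "y \<in> {y. y < q \<and> coprime y q}"
      using q_gt_1 totatives_less[of y q] by (auto simp: in_totatives_iff)
  qed
  finally show ?thesis by (simp add: totient_def)
qed

text \<open>Writing the index as \<open>y + q * s\<close> splits the sum into a geometric sum over
  \<open>s\<close> and a twisted sum over \<open>y\<close>. The first vanishes unless
  \<open>\<rho> ^ q = 1\<close>; in that case \<open>\<rho>\<close> is a power of
  \<open>unity q\<close> and the second is, up to a root of unity, a Gauss sum.\<close>

lemma twisted_root_sum:
  assumes "\<theta> = 0 \<or> \<theta> ^ N = 1" and "N = q * L * m" and "N > 0" and "m dvd M"
  shows "\<exists>\<eta>. (\<eta> = 0 \<or> root_of_unity \<eta>) \<and>
    (\<Sum>t<q * L. of_int (\<psi> (Suc t)) * \<theta> ^ Suc (M * t)) = of_nat L * gauss_sum \<psi> q 1 * \<eta>"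
proof (cases "\<theta> = 0")
  case True
  thus ?thesis by (intro exI[of _ 0]) simp
next
  case False
  hence \<theta>: "\<theta> ^ N = 1" using assms(1) by simp
  define \<rho> where "\<rho> = \<theta> ^ M"
  have "N dvd M * (q * L)" using assms(2,4) by (auto simp: mult_ac)
  hence \<rho>: "\<rho> ^ (q * L) = 1"
    unfolding \<rho>_def by (auto elim!: dvdE simp: power_mult[symmetric] \<theta> power_mult[of \<theta> N])
  have q0: "q > 0" using q_gt_1 by simp
  define S where "S = (\<Sum>y<q. of_int (\<psi> (Suc y)) * \<rho> ^ y)"
  have "(\<Sum>t<q * L. of_int (\<psi> (Suc t)) * \<theta> ^ Suc (M * t))
      = (\<Sum>s<L. \<Sum>y<q. \<theta> * (\<rho> ^ q) ^ s * (of_int (\<psi> (Suc y)) * \<rho> ^ y))"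
    unfolding sum_lessThan_mult
  proof (intro sum.cong refl)
    fix s y
    have "\<theta> ^ Suc (M * (y + q * s)) = \<theta> * (\<rho> ^ q) ^ s * \<rho> ^ y"
      by (simp add: \<rho>_def power_add power_mult[symmetric] algebra_simps)
    moreover have "\<psi> (Suc (y + q * s)) = \<psi> (Suc y)"
      using character_add_period[of "Suc y" s] by simp
    ultimately show "of_int (\<psi> (Suc (y + q * s))) * \<theta> ^ Suc (M * (y + q * s))
        = \<theta> * (\<rho> ^ q) ^ s * (of_int (\<psi> (Suc y)) * \<rho> ^ y)" by (simp only: mult_ac)
  qed
  also have "\<dots> = \<theta> * (\<Sum>s<L. (\<rho> ^ q) ^ s) * S"
    unfolding S_def mult.assoc[of \<theta>] sum_product by (simp add: sum_distrib_left mult_ac)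
  finally have eq: "(\<Sum>t<q * L. of_int (\<psi> (Suc t)) * \<theta> ^ Suc (M * t))
      = \<theta> * (\<Sum>s<L. (\<rho> ^ q) ^ s) * S" .
  have geo: "(\<Sum>s<L. (\<rho> ^ q) ^ s) = (if \<rho> ^ q = 1 then of_nat L else 0)"
    by (rule sum_power_root_of_unity) (use \<rho> in \<open>simp add: power_mult\<close>)
  show ?thesis
  proof (cases "\<rho> ^ q = 1")
    case False
    thus ?thesis using eq geo by (intro exI[of _ 0]) simp
  next
    case True
    then obtain r where r: "\<rho> = unity q ^ r" using power_eq_1_imp_unity_power q0 by blast
    \<comment> \<open>In \<open>S\<close> the character is one index ahead of the power; a factor
      \<open>\<rho>\<close> aligns them, and \<open>\<rho> ^ (q - 1)\<close>, its inverse, is put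
      back afterwards.\<close>
    have "\<rho> * S = (\<Sum>y<q. of_int (\<psi> (Suc y)) * \<rho> ^ Suc y)"
      by (simp add: S_def sum_distrib_left mult_ac)
    also have "\<dots> = (\<Sum>y<q. of_int (\<psi> y) * \<rho> ^ y)"
      by (rule sum_shift_period) (use True periodic[of q] in simp)
    also have "\<dots> = gauss_sum \<psi> q r"
      unfolding gauss_sum_def r power_mult ..
    also have "\<dots> = of_int (\<psi> r) * gauss_sum \<psi> q 1" by (rule separable)
    finally have "\<rho> * S = of_int (\<psi> r) * gauss_sum \<psi> q 1" .
    moreover have "S = \<rho> ^ (q - 1) * (\<rho> * S)"
      using True q0 by (simp add: mult.assoc[symmetric] power_Suc2[symmetric] del: power_Suc)
    ultimately have S: "S = \<rho> ^ (q - 1) * of_int (\<psi> r) * gauss_sum \<psi> q 1" by simp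
    define \<eta> where "\<eta> = \<theta> * \<rho> ^ (q - 1) * of_int (\<psi> r)"
    have root_pow: "root_of_unity (x ^ j)" if "root_of_unity x" for x j
      using that by (auto simp: root_of_unity_def power_mult[symmetric] mult.commute[of j])
        (metis power_mult power_one)
    have "root_of_unity \<theta>" using \<theta> assms(3) by (auto simp: root_of_unity_def)
    hence "root_of_unity (\<theta> * \<rho> ^ (q - 1))"
      unfolding \<rho>_def by (intro root_of_unity_mult root_pow)
    moreover have "root_of_unity 1" "root_of_unity (-1)"
      by (auto simp: root_of_unity_def intro: exI[of _ 2])
    ultimately have "\<eta> = 0 \<or> root_of_unity \<eta>"
      using character_values[of r] root_of_unity_mult unfolding \<eta>_def by fastforce
    moreover have "(\<Sum>t<q * L. of_int (\<psi> (Suc t)) * \<theta> ^ Suc (M * t))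
        = of_nat L * gauss_sum \<psi> q 1 * \<eta>"
      unfolding eq geo by (simp add: True S \<eta>_def)
    ultimately show ?thesis by blast
  qed
qed

text \<open>Average the conjugates \<open>\<zeta> \<mapsto> \<zeta> ^ k\<close>, \<open>k \<equiv> 1\<close> modulo the part of the level prime to \<open>l\<close>,
  with weights \<open>\<psi> k\<close>. This kills \<open>A\<close>, multiplies the Gauss sum by \<open>totient q\<close>, and sends every
  root of unity to zero or to a root of unity times the Gauss sum.\<close>

lemma root_sum_twist:
  assumes "root_sum n (A + gauss_sum \<psi> q 1 * w)"
    and "A \<in> cyclotomic_integers m0" and "w \<in> cyclotomic_integers m0" and "\<not> l dvd m0"
  shows "root_sum n (of_nat (totient q) * w)"
proof -
  let ?G = "gauss_sum \<psi> q 1"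
  obtain \<theta> where \<theta>: "\<forall>i<n. \<theta> i = 0 \<or> root_of_unity (\<theta> i)" and
    \<theta>_sum: "A + ?G * w = (\<Sum>i<n. \<theta> i)"
    using assms(1) by (auto simp: root_sum_def)
  have "\<exists>k>0. \<theta> i = 0 \<or> \<theta> i ^ k = 1" if "i < n" for i
    using \<theta> that by (auto simp: root_of_unity_def)
  then obtain d where d: "\<And>i. i < n \<Longrightarrow> d i > (0 :: nat) \<and> (\<theta> i = 0 \<or> \<theta> i ^ d i = 1)"
    by metis
  \<comment> \<open>A common level: all nonzero \<open>\<theta> i\<close> are \<open>N\<close>-th
    roots of unity, and \<open>q * m0\<close> accounts for the Gauss sum, \<open>A\<close> and
    \<open>w\<close>.\<close>
  define N where "N = q * m0 * (\<Prod>i<n. d i)"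
  have m0: "m0 > 0" using assms(4) by (cases "m0 = 0") auto
  have q0: "q > 0" using q_gt_1 by simp
  have N0: "N > 0" unfolding N_def using d m0 q0 by (auto intro!: prod_pos)
  have \<theta>N: "\<theta> i = 0 \<or> \<theta> i ^ N = 1" if "i < n" for i
  proof -
    have "d i dvd N" unfolding N_def using that by (intro dvd_mult dvd_prodI) auto
    thus ?thesis using d[OF that] by (auto elim!: dvdE simp: power_mult)
  qed
  \<comment> \<open>Split the level into its \<open>l\<close>-part, a multiple of \<open>q\<close>,
    and the part \<open>m\<close> prime to \<open>l\<close>, a multiple of
    \<open>m0\<close>.\<close>
  obtain v m where vm: "N = l ^ v * m" "\<not> l dvd m"
    by (rule multiplicity_decompose'[of N l]) (use N0 l_gt_1 in auto)
  have cop: "coprime (l ^ j) m" "coprime (l ^ j) m0" for j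
    using vm(2) assms(4) prime_l by (simp_all add: prime_imp_coprime)
  have "q dvd l ^ v * m" unfolding vm(1)[symmetric] by (simp add: N_def)
  hence "q dvd l ^ v" using cop(1)[of s] by (simp add: q_def coprime_dvd_mult_left_iff)
  then obtain L where L: "l ^ v = q * L" by (elim dvdE)
  have NL: "N = q * L * m" using vm(1) L by simp
  have L0: "L > 0" and m_pos: "m > 0" using N0 NL by auto
  have "m0 dvd l ^ v * m" unfolding vm(1)[symmetric] by (simp add: N_def)
  hence m0m: "m0 dvd m" using cop(2)[of v] by (simp add: coprime_dvd_mult_right_iff coprime_commute)
  \<comment> \<open>\<open>M\<close> is 0 modulo \<open>m\<close> and, by Euler, 1 modulo
    \<open>q\<close>. Thus \<open>k = 1 + M * t\<close> is 1 modulo \<open>m\<close>, which fixes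
    \<open>A\<close> and \<open>w\<close>, and \<open>Suc t\<close> modulo \<open>q\<close>, which
    explains the weight \<open>\<psi> (Suc t)\<close>.\<close>
  define M where "M = m ^ totient q"
  have mM: "m dvd M" unfolding M_def using q0 by (intro dvd_power) auto
  have M1: "[M = 1] (mod q)"
    unfolding M_def using cop(1)[of s] by (intro euler_theorem) (simp add: q_def coprime_commute)
  \<comment> \<open>If \<open>Suc t\<close> is coprime to \<open>q\<close>, the exponent is coprime
    to \<open>N\<close> and defines a conjugation; otherwise the weight is zero.\<close>
  have conj: "of_int (\<psi> (Suc t)) * (\<Sum>i<n. \<theta> i ^ Suc (M * t))
      = of_int (\<psi> (Suc t)) * A + of_int (\<psi> (Suc t) * \<psi> (Suc t)) * (?G * w)" for t
  proof (cases "coprime (Suc t) q")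
    case False
    thus ?thesis using character_eq_0 by simp
  next
    case True
    define k where "k = Suc (M * t)"
    have "[1 + M * t = 1 + 0] (mod m)"
      using mM by (intro cong_add cong_refl) (simp add: cong_0_iff)
    hence km: "[k = 1] (mod m)" by (simp add: k_def)
    have kq: "[k = Suc t] (mod q)"
      using cong_add[OF cong_refl[of 1] cong_mult[OF M1 cong_refl[of t]]] by (simp add: k_def)
    have "coprime k q" using True kq cong_imp_coprime cong_sym by blast
    hence "coprime k (l ^ v)" using s_pos by (simp add: q_def)
    moreover have "coprime k m" using km cong_imp_coprime[of 1 k m] cong_sym by auto
    ultimately have kN: "coprime k N" by (simp add: vm(1))
    have "[k = 1] (mod m0)" using km m0m cong_dvd_modulus_nat by blast
    moreover have "m0 dvd N" by (simp add: N_def)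
    ultimately have fixed: "conjugate_pair N k A A" "conjugate_pair N k w w"
      using assms(2,3) N0 conjugate_pair_fixed by blast+
    have root: "conjugate_pair N k (\<theta> i) (\<theta> i ^ k)" if "i < n" for i
    proof (cases "\<theta> i = 0")
      case True
      thus ?thesis using conjugate_pair_of_int[of N k 0] by (simp add: k_def)
    next
      case False
      thus ?thesis using \<theta>N[OF that] N0 conjugate_pair_root by blast
    qed
    have "conjugate_pair N k ?G (\<Sum>y<q. of_int (\<psi> y) * (unity q ^ y) ^ k)"
      unfolding gauss_sum_def mult_1
    proof (intro conjugate_pair_sum conjugate_pair_mult conjugate_pair_of_int conjugate_pair_root N0)
      fix y
      have "(unity q ^ y) ^ N = ((unity q ^ q) ^ y) ^ (L * m)"
        unfolding NL by (simp only: power_mult[symmetric] mult_ac)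
      thus "(unity q ^ y) ^ N = 1" by (simp add: unity_power_self q0)
    qed
    also have "(\<Sum>y<q. of_int (\<psi> y) * (unity q ^ y) ^ k) = gauss_sum \<psi> q k"
      by (simp add: gauss_sum_def power_mult[symmetric] mult.commute)
    also have "\<dots> = of_int (\<psi> (Suc t)) * ?G"
      using kq separable[of k] periodic[of k] periodic[of "Suc t"] by (simp add: cong_def)
    finally have "conjugate_pair N k (A + ?G * w) (A + of_int (\<psi> (Suc t)) * ?G * w)"
      by (intro conjugate_pair_add conjugate_pair_mult fixed)
    moreover have "conjugate_pair N k (A + ?G * w) (\<Sum>i<n. \<theta> i ^ k)"
      unfolding \<theta>_sum by (intro conjugate_pair_sum root) simp
    ultimately have "(\<Sum>i<n. \<theta> i ^ k) = A + of_int (\<psi> (Suc t)) * ?G * w"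
      using conjugate_pair_unique N0 kN by blast
    thus ?thesis by (simp add: k_def algebra_simps)
  qed
  have shift: "(\<Sum>t<q * L. f (Suc t)) = int L * (\<Sum>y<q. f y)"
    if "\<And>x y. f (x + q * y) = f x" for f :: "nat \<Rightarrow> int"
  proof -
    have "(\<Sum>t<q * L. f (Suc t)) = (\<Sum>j<L. \<Sum>y<q. f (Suc y))"
      unfolding sum_lessThan_mult using that[of "Suc _"] by simp
    also have "(\<Sum>y<q. f (Suc y)) = (\<Sum>y<q. f y)"
      by (rule sum_shift_period) (use that[of 0 1] in simp)
    finally show ?thesis by simp
  qed
  have "\<exists>\<eta>. (\<eta> = 0 \<or> root_of_unity \<eta>) \<and>
      (\<Sum>t<q * L. of_int (\<psi> (Suc t)) * \<theta> i ^ Suc (M * t)) = of_nat L * ?G * \<eta>" if "i < n" for i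
    by (rule twisted_root_sum[OF \<theta>N[OF that] NL N0 mM])
  then obtain \<eta> where \<eta>: "\<And>i. i < n \<Longrightarrow> \<eta> i = 0 \<or> root_of_unity (\<eta> i)"
    and \<eta>_eq: "\<And>i. i < n \<Longrightarrow>
      (\<Sum>t<q * L. of_int (\<psi> (Suc t)) * \<theta> i ^ Suc (M * t)) = of_nat L * ?G * \<eta> i"
    by metis
  \<comment> \<open>Evaluate the weighted double sum root by root and conjugate by conjugate, then
    cancel \<open>L\<close> times the Gauss sum.\<close>
  have "of_nat L * ?G * (\<Sum>i<n. \<eta> i)
      = (\<Sum>i<n. \<Sum>t<q * L. of_int (\<psi> (Suc t)) * \<theta> i ^ Suc (M * t))"
    unfolding sum_distrib_left by (intro sum.cong refl) (simp only: \<eta>_eq lessThan_iff)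
  also have "\<dots> = (\<Sum>t<q * L. of_int (\<psi> (Suc t)) * (\<Sum>i<n. \<theta> i ^ Suc (M * t)))"
    by (subst sum.swap) (simp only: sum_distrib_left)
  also have "\<dots> = of_int (\<Sum>t<q * L. \<psi> (Suc t)) * A
      + of_int (\<Sum>t<q * L. \<psi> (Suc t) * \<psi> (Suc t)) * (?G * w)"
    unfolding conj by (simp only: sum.distrib sum_distrib_right of_int_sum)
  also have "(\<Sum>t<q * L. \<psi> (Suc t)) = 0"
    using shift[of \<psi>] character_add_period character_sum by simp
  also have "(\<Sum>t<q * L. \<psi> (Suc t) * \<psi> (Suc t)) = int L * int (totient q)"
    using shift[of "\<lambda>t. \<psi> t * \<psi> t"] character_add_period character_square_sum by simp
  finally have "(of_nat L * ?G) * (\<Sum>i<n. \<eta> i) = (of_nat L * ?G) * (of_nat (totient q) * w)"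
    by (simp add: mult_ac)
  hence "of_nat (totient q) * w = (\<Sum>i<n. \<eta> i)"
    using L0 gauss_sum_nonzero by simp
  thus ?thesis using \<eta> unfolding root_sum_def by blast
qed

end

section \<open>Characters modulo 8 and modulo odd primes\<close>

text \<open>The Kronecker symbol of 2, the real primitive character belonging to the field generated
  by \<open>sqrt 2\<close>.\<close>

definition octic_character :: "nat \<Rightarrow> int" where
  "octic_character x =
     (if x mod 8 \<in> {1, 7} then 1 else if x mod 8 \<in> {3, 5} then -1 else 0)"

lemma unity_8: "unity 8 = (1 + \<i>) * of_real (sqrt 2 / 2)"
  by (simp add: unity_def complex_eq_iff cos_45 sin_45)

lemma unity_8_power_4: "unity 8 ^ 4 = -1"
proof -
  have "unity 8 ^ 2 = \<i>"
    unfolding unity_8 by (simp add: power2_eq_square complex_eq_iff)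
  hence "(unity 8 ^ 2) ^ 2 = -1" by simp
  thus ?thesis by (simp flip: power_mult)
qed

lemma sqrt_2_conv_unity_8: "of_real (sqrt 2) = unity 8 - unity 8 ^ 3"
  unfolding unity_8 by (simp add: complex_eq_iff power3_eq_cube)

text \<open>Since \<open>x ^ 4 = -1\<close>, all powers reduce to exponents below 4, and the eight
  residues of \<open>r\<close> can be checked separately.\<close>

lemma gauss_sum_octic:
  "gauss_sum octic_character 8 r = of_int (octic_character r) * (2 * of_real (sqrt 2))"
proof -
  define x where "x = unity 8"
  have x4: "x ^ 4 = -1" using unity_8_power_4 by (simp add: x_def)
  have x8: "x ^ 8 = 1" using power_mult[of x 4 2] x4 by simp
  have high: "x ^ 5 = - x" "x ^ 6 = - (x ^ 2)" "x ^ 7 = - (x ^ 3)"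
    using power_add[of x 4 1] power_add[of x 4 2] power_add[of x 4 3] by (simp_all add: x4)
  have red: "x ^ (r * j) = x ^ (r mod 8 * j mod 8)" for j
    using power_mod_of_power_eq_1[OF x8, of "r * j"] by (simp add: mod_mult_left_eq)
  have "gauss_sum octic_character 8 r = x ^ (r * 1) - x ^ (r * 3) - x ^ (r * 5) + x ^ (r * 7)"
    unfolding gauss_sum_def x_def[symmetric]
    by (simp add: lessThan_nat_numeral octic_character_def)
  hence eq: "gauss_sum octic_character 8 r = x ^ (r mod 8 * 1 mod 8) - x ^ (r mod 8 * 3 mod 8)
      - x ^ (r mod 8 * 5 mod 8) + x ^ (r mod 8 * 7 mod 8)"
    by (simp only: red)
  have s2: "of_real (sqrt 2) = x - x ^ 3" using sqrt_2_conv_unity_8 by (simp add: x_def)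
  consider "r mod 8 = 0" | "r mod 8 = 1" | "r mod 8 = 2" | "r mod 8 = 3"
    | "r mod 8 = 4" | "r mod 8 = 5" | "r mod 8 = 6" | "r mod 8 = 7"
    by linarith
  thus ?thesis unfolding eq octic_character_def s2
    by cases (simp_all add: high x4)
qed

lemma primitive_octic: "primitive_real_character octic_character 2 3 8"
proof
  show "gauss_sum octic_character 8 r
      = of_int (octic_character r) * gauss_sum octic_character 8 1" for r
    unfolding gauss_sum_octic by (simp add: octic_character_def)
  show "gauss_sum octic_character 8 1 \<noteq> 0"
    unfolding gauss_sum_octic by (simp add: octic_character_def)
  show "octic_character x * octic_character x = (if coprime x 8 then 1 else 0)" for x
  proof -
    have "coprime x 8 \<longleftrightarrow> odd x"
      using coprime_power_right_iff[of x 2 3] by simp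
    hence cop: "coprime x 8 \<longleftrightarrow> x mod 8 mod 2 = 1"
      by (simp add: mod_mod_cancel odd_iff_mod_2_eq_one)
    consider "x mod 8 = 0" | "x mod 8 = 1" | "x mod 8 = 2" | "x mod 8 = 3"
      | "x mod 8 = 4" | "x mod 8 = 5" | "x mod 8 = 6" | "x mod 8 = 7"
      by linarith
    thus ?thesis unfolding cop octic_character_def by cases simp_all
  qed
  show "octic_character (x mod 8) = octic_character x" for x
    by (simp add: octic_character_def)
qed simp_all

section \<open>The Legendre symbol and its Gauss sums\<close>

lemma unity_power_eq_1_iff:
  assumes "n > 0"
  shows "unity n ^ j = 1 \<longleftrightarrow> n dvd j"
proof -
  have "unity n ^ j = exp (2 * of_real pi * \<i> * of_nat j / of_nat n)"
    by (simp add: unity_def cis_conv_exp exp_of_nat_mult[symmetric] mult_ac)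
  thus ?thesis using complex_root_unity_eq_1[of n j] assms by simp
qed

definition quadratic_character :: "nat \<Rightarrow> nat \<Rightarrow> int" where
  "quadratic_character p x = Legendre (int x) (int p)"

lemma sum_reindex_mult_mod:
  fixes f :: "nat \<Rightarrow> 'a :: comm_monoid_add"
  assumes "coprime r p" and "p > 0"
  shows "(\<Sum>y<p. f (r * y mod p)) = (\<Sum>y<p. f y)"
proof -
  have inj: "inj_on (\<lambda>y. r * y mod p) {..<p}"
  proof (rule inj_onI)
    fix x y assume "x \<in> {..<p}" "y \<in> {..<p}" "r * x mod p = r * y mod p"
    moreover from this have "[x = y] (mod p)"
      using assms(1) cong_mult_lcancel_nat[of r p x y] by (simp add: cong_def)
    ultimately show "x = y" by (simp add: cong_def)
  qed
  have "bij_betw (\<lambda>y. r * y mod p) {..<p} {..<p}"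
    unfolding bij_betw_def using inj assms(2)
    by (intro conjI endo_inj_surj) auto
  thus ?thesis by (rule sum.reindex_bij_betw)
qed

context
  fixes p :: nat
  assumes prime_p: "prime p" and p_odd: "p > 2"
begin

lemma quadratic_character_values: "quadratic_character p x \<in> {-1, 0, 1}"
  by (simp add: quadratic_character_def Legendre_def)

lemma quadratic_character_mod: "quadratic_character p (x mod p) = quadratic_character p x"
  by (simp add: quadratic_character_def Legendre_def QuadRes_def cong_def zmod_int)

lemma quadratic_character_eq_0_iff: "quadratic_character p x = 0 \<longleftrightarrow> p dvd x"
  by (simp add: quadratic_character_def Legendre_def cong_0_iff)

text \<open>Euler's criterion gives the identity modulo \<open>p\<close>; both sides lie between -1
  and 1, and \<open>p > 2\<close> turns the congruence into equality.\<close>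

lemma quadratic_character_mult:
  "quadratic_character p (x * y) = quadratic_character p x * quadratic_character p y"
proof -
  have euler: "[quadratic_character p z = int z ^ ((nat (int p) - 1) div 2)] (mod int p)" for z
    using euler_criterion[of p "int z"] prime_p p_odd by (simp add: quadratic_character_def)
  have "[quadratic_character p (x * y) = quadratic_character p x * quadratic_character p y] (mod int p)"
    using euler[of "x * y"] cong_mult[OF euler[of x] euler[of y]]
    by (simp add: power_mult_distrib cong_def)
  hence "int p dvd quadratic_character p (x * y) - quadratic_character p x * quadratic_character p y"
    by (simp add: cong_iff_dvd_diff)
  moreover have "\<bar>quadratic_character p (x * y) - quadratic_character p x * quadratic_character p y\<bar> < int p"
    using quadratic_character_values[of "x * y"] quadratic_character_values[of x]
      quadratic_character_values[of y] p_odd by auto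
  ultimately show ?thesis
    using zdvd_imp_le[of "int p" "\<bar>quadratic_character p (x * y) - quadratic_character p x * quadratic_character p y\<bar>"]
    by fastforce
qed

lemma quadratic_character_square:
  "quadratic_character p x * quadratic_character p x = (if coprime x p then 1 else 0)"
proof -
  have "coprime x p \<longleftrightarrow> quadratic_character p x \<noteq> 0"
    using prime_p quadratic_character_eq_0_iff[of x]
    by (metis coprime_commute prime_imp_coprime coprime_absorb_left not_prime_unit)
  thus ?thesis using quadratic_character_values[of x] by auto
qed

text \<open>Otherwise squaring would be surjective, hence injective, on residues, although 1 and
  \<open>p - 1\<close> have the same square.\<close>

lemma quadratic_nonresidue_exists: "\<exists>g. quadratic_character p g = -1"
proof (rule ccontr)
  assume no: "\<not> ?thesis"
  define f where "f = (\<lambda>y. y ^ 2 mod p)"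
  have "f ` {..<p} = {..<p}"
  proof
    show "f ` {..<p} \<subseteq> {..<p}" using p_odd by (auto simp: f_def)
    show "{..<p} \<subseteq> f ` {..<p}"
    proof
      fix x assume x: "x \<in> {..<p}"
      show "x \<in> f ` {..<p}"
      proof (cases "x = 0")
        case True
        thus ?thesis using p_odd by (intro image_eqI[of _ _ 0]) (auto simp: f_def)
      next
        case False
        hence "quadratic_character p x \<noteq> 0"
          using x by (auto simp: quadratic_character_eq_0_iff dest: dvd_imp_le)
        hence "quadratic_character p x = 1"
          using no quadratic_character_values[of x] by auto
        hence "QuadRes (int p) (int x)"
          by (auto simp: quadratic_character_def Legendre_def split: if_splits)
        then obtain y where y: "[y ^ 2 = int x] (mod int p)" by (auto simp: QuadRes_def)
        define z where "z = nat (y mod int p)"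
        have z: "int z = y mod int p" using p_odd by (simp add: z_def)
        have "int (z ^ 2 mod p) = (int z) ^ 2 mod int p" by (simp add: zmod_int)
        also have "\<dots> = y ^ 2 mod int p" by (simp add: z power_mod)
        also have "\<dots> = int x" using y x by (simp add: cong_def)
        finally have "f z = x" by (simp add: f_def)
        moreover have "z < p" using z p_odd
          by (metis of_nat_less_iff pos_mod_bound of_nat_0_less_iff zero_less_numeral less_trans)
        ultimately show ?thesis by blast
      qed
    qed
  qed
  hence "inj_on f {..<p}" by (intro eq_card_imp_inj_on) simp_all
  moreover have "f (p - 1) = f 1"
  proof -
    have "[int (p - 1) = -1] (mod int p)" using p_odd by (simp add: cong_iff_dvd_diff of_nat_diff)
    hence "[int (p - 1) ^ 2 = (-1) ^ 2] (mod int p)" by (rule cong_pow)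
    hence "int ((p - 1) ^ 2 mod p) = int (1 ^ 2 mod p)" by (simp only: cong_def of_nat_mod of_nat_power) simp
    thus ?thesis unfolding f_def by (simp only: of_nat_eq_iff)
  qed
  ultimately have "p - 1 = 1" using p_odd by (auto dest: inj_onD)
  thus False using p_odd by simp
qed

text \<open>Multiplication by a nonresidue permutes the residues and negates the sum.\<close>

lemma quadratic_character_sum: "(\<Sum>y<p. quadratic_character p y) = 0"
proof -
  obtain g where g: "quadratic_character p g = -1" using quadratic_nonresidue_exists by blast
  have "coprime g p" using quadratic_character_square[of g] g by (simp split: if_splits)
  have "(\<Sum>y<p. quadratic_character p (g * y mod p)) = (\<Sum>y<p. quadratic_character p y)"
    using \<open>coprime g p\<close> p_odd by (intro sum_reindex_mult_mod) auto
  hence "- (\<Sum>y<p. quadratic_character p y) = (\<Sum>y<p. quadratic_character p y)"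
    by (simp add: quadratic_character_mod quadratic_character_mult g sum_negf)
  thus ?thesis by simp
qed

text \<open>For \<open>r\<close> prime to \<open>p\<close>, substitute \<open>r * y\<close> for
  \<open>y\<close>. If \<open>p\<close> divides \<open>r\<close>, the exponential factors are 1 and
  the character sum vanishes.\<close>

lemma gauss_sum_quadratic_separable:
  "gauss_sum (quadratic_character p) p r
     = of_int (quadratic_character p r) * gauss_sum (quadratic_character p) p 1"
proof (cases "coprime r p")
  case True
  have u: "unity p ^ p = 1" using p_odd by (simp add: unity_power_self)
  have "gauss_sum (quadratic_character p) p 1
      = (\<Sum>y<p. of_int (quadratic_character p (r * y mod p)) * unity p ^ (r * y mod p))"
    using sum_reindex_mult_mod[OF True, of "\<lambda>y. of_int (quadratic_character p y) * unity p ^ y"] p_odd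
    by (simp add: gauss_sum_def)
  also have "\<dots> = of_int (quadratic_character p r) * gauss_sum (quadratic_character p) p r"
    by (simp add: quadratic_character_mod quadratic_character_mult power_mod_of_power_eq_1[OF u]
        gauss_sum_def sum_distrib_left mult_ac)
  finally have "of_int (quadratic_character p r) * gauss_sum (quadratic_character p) p 1
      = of_int (quadratic_character p r * quadratic_character p r) * gauss_sum (quadratic_character p) p r"
    by simp
  thus ?thesis using True by (simp add: quadratic_character_square)
next
  case False
  hence "quadratic_character p r = 0" using quadratic_character_square[of r] by simp
  hence "p dvd r" by (simp add: quadratic_character_eq_0_iff)
  hence "unity p ^ (r * y) = 1" for y
    using p_odd by (auto elim!: dvdE simp: power_mult unity_power_self)
  hence "gauss_sum (quadratic_character p) p r = of_int (\<Sum>y<p. quadratic_character p y)"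
    by (simp add: gauss_sum_def)
  thus ?thesis using \<open>quadratic_character p r = 0\<close> by (simp add: quadratic_character_sum)
qed

text \<open>Both sides come from computing \<open>\<Sum>r<p. (gauss_sum r)\<^sup>2\<close>: by separability, and by
  orthogonality of the additive characters.\<close>

lemma gauss_sum_quadratic_square:
  "(gauss_sum (quadratic_character p) p 1)\<^sup>2 = of_int (quadratic_character p (p - 1)) * of_nat p"
proof -
  let ?c = "\<lambda>y. of_int (quadratic_character p y) :: complex"
  let ?G = "gauss_sum (quadratic_character p) p 1"
  have u: "unity p ^ p = 1" using p_odd by (simp add: unity_power_self)
  have p0: "p > 0" using p_odd by simp
  have sq: "(\<Sum>y<p. ?c y * ?c y) = of_nat (p - 1)"
  proof -
    have "?c y * ?c y = (if y = 0 then 0 else 1)" if "y < p" for y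
      using quadratic_character_eq_0_iff[of y] quadratic_character_values[of y] that
      by (auto dest: dvd_imp_le)
    hence "(\<Sum>y<p. ?c y * ?c y) = (\<Sum>y<p. if y = 0 then 0 else 1)" by simp
    also have "\<dots> = (\<Sum>y\<in>{..<p} - {0}. 1)" using p0
      by (intro sum.mono_neutral_cong_right) auto
    also have "\<dots> = of_nat (p - 1)" using p0 by simp
    finally show ?thesis .
  qed
  have orth: "(\<Sum>r<p. unity p ^ (r * j)) = (if p dvd j then of_nat p else 0)" for j
  proof -
    have "(\<Sum>r<p. unity p ^ (r * j)) = (\<Sum>r<p. (unity p ^ j) ^ r)"
      by (simp add: power_mult[symmetric] mult.commute)
    also have "\<dots> = (if unity p ^ j = 1 then of_nat p else 0)"
      by (rule sum_power_root_of_unity) (simp add: power_mult[symmetric] mult.commute[of j], simp add: power_mult u)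
    also have "unity p ^ j = 1 \<longleftrightarrow> p dvd j"
      by (rule unity_power_eq_1_iff[OF p0])
    finally show ?thesis .
  qed
  have "of_nat (p - 1) * ?G\<^sup>2 = (\<Sum>r<p. (?c r * ?G)\<^sup>2)"
    unfolding sq[symmetric] sum_distrib_right
    by (simp add: power2_eq_square mult_ac)
  also have "\<dots> = (\<Sum>r<p. (gauss_sum (quadratic_character p) p r)\<^sup>2)"
    by (intro sum.cong refl arg_cong[where f = "\<lambda>x. x\<^sup>2"] gauss_sum_quadratic_separable[symmetric])
  also have "\<dots> = (\<Sum>r<p. \<Sum>y<p. \<Sum>z<p. ?c y * ?c z * unity p ^ (r * (y + z)))"
    unfolding gauss_sum_def power2_eq_square sum_product
    by (simp add: power_add algebra_simps)
  also have "\<dots> = (\<Sum>y<p. \<Sum>z<p. \<Sum>r<p. ?c y * ?c z * unity p ^ (r * (y + z)))"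
    by (rule trans[OF sum.swap], rule sum.cong[OF refl], rule sum.swap)
  also have "\<dots> = (\<Sum>y<p. \<Sum>z<p. ?c y * ?c z * (if p dvd y + z then of_nat p else 0))"
    by (simp only: sum_distrib_left[symmetric] orth)
  also have "\<dots> = (\<Sum>y<p. of_int (quadratic_character p (p - 1)) * of_nat p * (?c y * ?c y))"
  proof (intro sum.cong refl)
    fix y
    \<comment> \<open>The residue of \<open>- y\<close>, written as a multiple of
      \<open>p - 1\<close> so that multiplicativity produces the sign
      \<open>quadratic_character p (p - 1)\<close>.\<close>
    define z0 where "z0 = (p - 1) * y mod p"
    have dvd_iff: "p dvd y + z \<longleftrightarrow> z = z0" if "z < p" for z
    proof -
      have "p dvd y + z0"
      proof -
        have "(y + (p - 1) * y) mod p = p * y mod p"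
          using p0 by (cases p) auto
        thus ?thesis by (simp add: z0_def dvd_eq_mod_eq_0 mod_simps)
      qed
      hence "[y + z0 = 0] (mod p)" by (simp add: cong_0_iff)
      hence "p dvd y + z \<longleftrightarrow> [y + z = y + z0] (mod p)"
        by (metis cong_0_iff cong_sym cong_trans)
      also have "\<dots> \<longleftrightarrow> [z = z0] (mod p)" by (rule cong_add_lcancel_nat)
      also have "\<dots> \<longleftrightarrow> z = z0" using that p0 by (simp add: cong_def z0_def)
      finally show ?thesis .
    qed
    have "(\<Sum>z<p. ?c y * ?c z * (if p dvd y + z then of_nat p else 0))
        = (\<Sum>z<p. if z = z0 then ?c y * ?c z0 * of_nat p else 0)"
      by (intro sum.cong refl) (simp add: dvd_iff)
    also have "\<dots> = ?c y * ?c z0 * of_nat p" using p0 by (simp add: z0_def)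
    also have "?c z0 = ?c (p - 1) * ?c y"
      by (simp add: z0_def quadratic_character_mod quadratic_character_mult)
    finally show "(\<Sum>z<p. ?c y * ?c z * (if p dvd y + z then of_nat p else 0))
        = of_int (quadratic_character p (p - 1)) * of_nat p * (?c y * ?c y)" by (simp add: mult_ac)
  qed
  also have "\<dots> = of_nat (p - 1) * (of_int (quadratic_character p (p - 1)) * of_nat p)"
    by (simp only: sum_distrib_left[symmetric] sq mult.commute)
  finally show ?thesis using p_odd by simp
qed

text \<open>The sign may stay open: a fourth root of unity absorbs it later.\<close>

lemma gauss_sum_quadratic_square_cases:
  "(gauss_sum (quadratic_character p) p 1)\<^sup>2 = of_nat p \<or>
   (gauss_sum (quadratic_character p) p 1)\<^sup>2 = - of_nat p"
proof -
  have "\<not> p dvd p - 1" using p_odd by (auto dest: dvd_imp_le)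
  hence "quadratic_character p (p - 1) \<noteq> 0" by (simp add: quadratic_character_eq_0_iff)
  thus ?thesis
    using quadratic_character_values[of "p - 1"] unfolding gauss_sum_quadratic_square by auto
qed

lemma primitive_quadratic: "primitive_real_character (quadratic_character p) p 1 p"
proof
  show "gauss_sum (quadratic_character p) p 1 \<noteq> 0"
    using gauss_sum_quadratic_square_cases p_odd by auto
qed (rule prime_p quadratic_character_mod quadratic_character_square
      gauss_sum_quadratic_separable | simp)+

end

section \<open>The lower bound\<close>

lemma gauss_sum_in_cyclotomic_integers:
  assumes "q > 0"
  shows "gauss_sum \<psi> q r \<in> cyclotomic_integers q"
  unfolding gauss_sum_def
proof (intro cyclotomic_integers_sum cyclotomic_integers_mult cyclotomic_integers_of_int
    cyclotomic_integers_root assms)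
  fix y
  have "(unity q ^ (r * y)) ^ q = (unity q ^ q) ^ (r * y)"
    by (simp only: power_mult[symmetric] mult.commute)
  thus "(unity q ^ (r * y)) ^ q = 1" using assms by (simp add: unity_power_self)
qed

abbreviation quadratic_gauss_sum :: "nat \<Rightarrow> complex" where
  "quadratic_gauss_sum p \<equiv> gauss_sum (quadratic_character p) p 1"

text \<open>The level includes 8 to leave room for coefficients such as \<open>sqrt 2\<close> and
  fourth roots of unity.\<close>

lemma prod_quadratic_gauss_sum_in_cyclotomic_integers:
  assumes "finite F" and "\<And>p. p \<in> F \<Longrightarrow> prime p"
  shows "(\<Prod>p\<in>F. quadratic_gauss_sum p) \<in> cyclotomic_integers (8 * \<Prod>F)"
  using assms
proof (induction F)
  case empty
  show ?case using cyclotomic_integers_of_int[of 1] by simp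
next
  case (insert p F)
  have pos: "8 * \<Prod>(insert p F) > 0"
    using insert by (intro mult_pos_pos prod_pos) (auto simp: prime_gt_0_nat)
  have "quadratic_gauss_sum p \<in> cyclotomic_integers p"
    using insert.prems by (intro gauss_sum_in_cyclotomic_integers) (auto simp: prime_gt_0_nat)
  moreover have "p dvd 8 * \<Prod>(insert p F)" using insert.hyps by simp
  ultimately have "quadratic_gauss_sum p \<in> cyclotomic_integers (8 * \<Prod>(insert p F))"
    using cyclotomic_integers_mono pos by blast
  moreover have "(\<Prod>p\<in>F. quadratic_gauss_sum p) \<in> cyclotomic_integers (8 * \<Prod>F)"
    using insert by simp
  hence "(\<Prod>p\<in>F. quadratic_gauss_sum p) \<in> cyclotomic_integers (8 * \<Prod>(insert p F))"
    using cyclotomic_integers_mono[OF _ pos, of "8 * \<Prod>F"] insert.hyps by (auto intro: mult_dvd_mono)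
  ultimately show ?case using insert.hyps by (simp add: cyclotomic_integers_mult)
qed

text \<open>One twist, by the character modulo \<open>p\<close>: the cofactor of its Gauss sum has
  level \<open>8 * \<Prod>F\<close>, which is prime to \<open>p\<close>.\<close>

lemma root_sum_cancel_quadratic_gauss_sum:
  assumes F: "finite F" "p \<notin> F" "\<And>r. r \<in> insert p F \<Longrightarrow> prime r \<and> r > 2"
    and "root_sum n (of_int a + u * (\<Prod>r\<in>insert p F. quadratic_gauss_sum r))"
    and "u \<in> cyclotomic_integers 8"
  shows "root_sum n (of_nat (p - 1) * (u * (\<Prod>r\<in>F. quadratic_gauss_sum r)))"
proof -
  have p: "prime p" "p > 2" using F(3) by auto
  interpret primitive_real_character "quadratic_character p" p 1 p
    by (rule primitive_quadratic[OF p])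
  have pos: "8 * \<Prod>F > 0"
    using F(3) by (intro mult_pos_pos prod_pos) (auto simp: prime_gt_0_nat)
  have "\<not> p dvd 8 * \<Prod>F"
  proof
    assume "p dvd 8 * \<Prod>F"
    hence "p dvd 2 ^ 3 \<or> p dvd \<Prod>F" using p(1) by (simp add: prime_dvd_mult_iff)
    thus False
    proof
      assume "p dvd 2 ^ 3"
      hence "p dvd 2" using p(1) prime_dvd_power by blast
      thus False using p(2) by (auto dest: dvd_imp_le)
    next
      assume "p dvd \<Prod>F"
      then obtain r where "r \<in> F" "p dvd r"
        using p(1) F(1) by (auto simp: prime_dvd_prod_iff)
      thus False using F(2,3) p(1) primes_dvd_imp_eq by blast
    qed
  qed
  moreover have "u * (\<Prod>r\<in>F. quadratic_gauss_sum r) \<in> cyclotomic_integers (8 * \<Prod>F)"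
    using assms(5) cyclotomic_integers_mono[OF _ pos, of 8] F(1,3)
    by (intro cyclotomic_integers_mult prod_quadratic_gauss_sum_in_cyclotomic_integers) auto
  moreover have "of_int a + u * (\<Prod>r\<in>insert p F. quadratic_gauss_sum r)
      = of_int a + quadratic_gauss_sum p * (u * (\<Prod>r\<in>F. quadratic_gauss_sum r))"
    by (simp only: prod.insert[OF F(1,2)] mult_ac)
  hence "root_sum n (of_int a + quadratic_gauss_sum p * (u * (\<Prod>r\<in>F. quadratic_gauss_sum r)))"
    using assms(4) by (simp only:)
  ultimately have "root_sum n (of_nat (totient p) * (u * (\<Prod>r\<in>F. quadratic_gauss_sum r)))"
    using cyclotomic_integers_of_int by (intro root_sum_twist)
  thus ?thesis using p(1) by (simp add: totient_prime)
qed

text \<open>Iterates the twist once the integer term is gone. \<open>u\<close> varies in the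
  induction because it collects the factors \<open>p - 1\<close>.\<close>

lemma root_sum_cancel_prod_gauss_sum:
  assumes "finite F" and "\<And>r. r \<in> F \<Longrightarrow> prime r \<and> r > 2"
    and "root_sum n (u * (\<Prod>r\<in>F. quadratic_gauss_sum r))" and "u \<in> cyclotomic_integers 8"
  shows "root_sum n (of_nat (\<Prod>r\<in>F. r - 1) * u)"
  using assms
proof (induction F arbitrary: u)
  case (insert p F)
  have "root_sum n (of_nat (p - 1) * (u * (\<Prod>r\<in>F. quadratic_gauss_sum r)))"
    using insert.hyps insert.prems
    by (intro root_sum_cancel_quadratic_gauss_sum[where a = 0]) auto
  hence "root_sum n ((of_nat (p - 1) * u) * (\<Prod>r\<in>F. quadratic_gauss_sum r))"
    by (simp only: mult.assoc)
  moreover have "of_nat (p - 1) * u \<in> cyclotomic_integers 8"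
    using cyclotomic_integers_mult[OF cyclotomic_integers_of_int insert.prems(3), of "int (p - 1)"]
    by simp
  ultimately have "root_sum n (of_nat (\<Prod>r\<in>F. r - 1) * (of_nat (p - 1) * u))"
    using insert.prems by (intro insert.IH) auto
  thus ?case using insert.hyps by (simp add: mult_ac)
qed simp

text \<open>The product of the Gauss sums squares to plus or minus \<open>\<Prod>F\<close>, so it
  differs from the root by 1, -1, \<open>\<i>\<close> or \<open>-\<i>\<close>.\<close>

lemma sqrt_prod_conv_gauss_sum:
  assumes "\<And>p. p \<in> F \<Longrightarrow> prime p \<and> p > 2"
  shows "\<exists>\<epsilon>. \<epsilon> ^ 4 = 1 \<and> of_real (sqrt (real (\<Prod>F))) = \<epsilon> * (\<Prod>p\<in>F. quadratic_gauss_sum p)"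
proof -
  let ?g = "\<Prod>p\<in>F. quadratic_gauss_sum p" and ?s = "complex_of_real (sqrt (real (\<Prod>F)))"
  have "?g\<^sup>2 = of_nat (\<Prod>F) \<or> ?g\<^sup>2 = - of_nat (\<Prod>F)"
    using assms
  proof (induction F rule: infinite_finite_induct)
    case (insert p F)
    show ?case
      using gauss_sum_quadratic_square_cases[of p] insert by (auto simp: power_mult_distrib)
  qed simp_all
  moreover have "?s\<^sup>2 = of_real (real (\<Prod>F))"
    by (simp only: of_real_power[symmetric] real_sqrt_pow2 of_nat_0_le_iff)
  ultimately have "?g\<^sup>2 = ?s\<^sup>2 \<or> ?g\<^sup>2 = (\<i> * ?s)\<^sup>2"
    by (simp add: power_mult_distrib)
  hence "?g = ?s \<or> ?g = - ?s \<or> ?g = \<i> * ?s \<or> ?g = - (\<i> * ?s)"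
    by (auto simp: power2_eq_iff)
  hence "?s = 1 * ?g \<or> ?s = (-1) * ?g \<or> ?s = (-\<i>) * ?g \<or> ?s = \<i> * ?g"
    by (auto simp: mult.assoc[symmetric])
  moreover have "1 ^ 4 = (1 :: complex)" "(-1) ^ 4 = (1 :: complex)" "(-\<i>) ^ 4 = 1" "\<i> ^ 4 = 1"
    by simp_all
  ultimately show ?thesis by blast
qed

lemma prod_prime_factors_squarefree:
  fixes m :: nat
  assumes "squarefree m" and "m > 0"
  shows "\<Prod>(prime_factors m) = m"
proof -
  have "m = (\<Prod>p\<in>prime_factors m. p ^ multiplicity p m)"
    using assms(2) by (rule prime_factorization_nat)
  also have "\<dots> = \<Prod>(prime_factors m)"
    using assms squarefree_factorial_semiring'[of m] by (intro prod.cong) auto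
  finally show ?thesis by simp
qed

lemma totient_squarefree:
  fixes m :: nat
  assumes "squarefree m" and "m > 0"
  shows "totient m = (\<Prod>p\<in>prime_factors m. p - 1)"
proof -
  have "totient (\<Prod>(prime_factors m)) = (\<Prod>p\<in>prime_factors m. totient p)"
    by (intro totient_prod_coprime)
      (auto simp: pairwise_def intro!: primes_coprime dest: in_prime_factors_imp_prime)
  also have "\<dots> = (\<Prod>p\<in>prime_factors m. p - 1)"
    by (intro prod.cong) (simp_all add: totient_prime in_prime_factors_imp_prime)
  finally show ?thesis using prod_prime_factors_squarefree[OF assms] by simp
qed

text \<open>As \<open>m > 1\<close>, some odd prime divides \<open>m\<close>, and its twist kills
  \<open>a\<close>; the other primes follow. \<open>\<kappa>\<close> will be \<open>b\<close> or
  \<open>b * sqrt 2\<close>.\<close>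

lemma root_sum_cancel_sqrt:
  fixes m :: nat
  assumes "squarefree m" and "odd m" and "m > 1" and "\<kappa> \<in> cyclotomic_integers 8"
    and "root_sum n (of_int a + \<kappa> * of_real (sqrt (real m)))"
  shows "root_sum n (of_nat (totient m) * \<kappa>)"
proof -
  define F where "F = prime_factors m"
  have F: "finite F" "\<And>p. p \<in> F \<Longrightarrow> prime p \<and> p > 2"
  proof -
    show "finite F" by (simp add: F_def)
    fix p assume "p \<in> F"
    hence p: "prime p" "p dvd m" by (auto simp: F_def)
    hence "p \<noteq> 2" using assms(2) by auto
    thus "prime p \<and> p > 2" using p(1) prime_ge_2_nat[of p] by simp
  qed
  have PF: "\<Prod>F = m" unfolding F_def using assms by (intro prod_prime_factors_squarefree) auto
  have "F \<noteq> {}" using PF assms(3) by auto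
  then obtain p where p: "p \<in> F" by blast
  define F' where "F' = F - {p}"
  have FF: "F = insert p F'" "p \<notin> F'" "finite F'" using p F(1) by (auto simp: F'_def)
  obtain \<epsilon> where \<epsilon>: "\<epsilon> ^ 4 = 1"
    "complex_of_real (sqrt (real m)) = \<epsilon> * (\<Prod>p\<in>F. quadratic_gauss_sum p)"
    using sqrt_prod_conv_gauss_sum[of F] F(2) PF by blast
  have \<epsilon>8: "\<epsilon> ^ 8 = 1" using \<epsilon>(1) power_mult[of \<epsilon> 4 2] by simp
  have u: "\<kappa> * \<epsilon> \<in> cyclotomic_integers 8"
    using assms(4) cyclotomic_integers_root[OF \<epsilon>8] by (intro cyclotomic_integers_mult) simp_all
  have "root_sum n (of_int a + (\<kappa> * \<epsilon>) * (\<Prod>r\<in>insert p F'. quadratic_gauss_sum r))"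
    using assms(5) \<epsilon>(2) by (simp add: FF(1) mult.assoc)
  hence "root_sum n (of_nat (p - 1) * ((\<kappa> * \<epsilon>) * (\<Prod>r\<in>F'. quadratic_gauss_sum r)))"
    using F(2) FF u by (intro root_sum_cancel_quadratic_gauss_sum) auto
  hence "root_sum n ((of_nat (p - 1) * (\<kappa> * \<epsilon>)) * (\<Prod>r\<in>F'. quadratic_gauss_sum r))"
    by (simp only: mult.assoc)
  moreover have "of_nat (p - 1) * (\<kappa> * \<epsilon>) \<in> cyclotomic_integers 8"
    using cyclotomic_integers_mult[OF cyclotomic_integers_of_int u, of "int (p - 1)"] by simp
  ultimately have "root_sum n (of_nat (\<Prod>r\<in>F'. r - 1) * (of_nat (p - 1) * (\<kappa> * \<epsilon>)))"
    using F(2) FF by (intro root_sum_cancel_prod_gauss_sum) auto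
  moreover have "totient m = (\<Prod>r\<in>F'. r - 1) * (p - 1)"
    using assms FF totient_squarefree[of m] by (simp add: F_def[symmetric])
  ultimately have "root_sum n (of_nat (totient m) * (\<kappa> * \<epsilon>))"
    by (simp add: mult_ac)
  \<comment> \<open>\<open>\<epsilon> ^ 3\<close> is the inverse of \<open>\<epsilon>\<close> and a
    root of unity, so this factor removes the remaining \<open>\<epsilon>\<close>.\<close>
  hence "root_sum n (\<epsilon> ^ 3 * (of_nat (totient m) * (\<kappa> * \<epsilon>)))"
  proof (rule root_sum_mult[rotated])
    have "(\<epsilon> ^ 3) ^ 4 = 1" using \<epsilon>(1) by (metis power_mult mult.commute power_one)
    thus "root_of_unity (\<epsilon> ^ 3)" by (auto simp: root_of_unity_def intro!: exI[of _ 4])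
  qed
  moreover have "\<epsilon> ^ 3 * (of_nat (totient m) * (\<kappa> * \<epsilon>)) = \<epsilon> ^ 4 * (of_nat (totient m) * \<kappa>)"
    by (simp add: power_numeral_reduce mult_ac)
  ultimately show ?thesis by (simp only: \<epsilon>(1) mult_1)
qed

text \<open>The Gauss sum of the character modulo 8 is \<open>2 * sqrt 2\<close>; doubling the sum of roots of unity
  avoids a half-integral coefficient.\<close>

lemma root_sum_sqrt_2_bound:
  assumes "root_sum n (of_int a + of_int b * of_real (sqrt 2))"
  shows "2 * \<bar>b\<bar> \<le> int n"
proof -
  interpret primitive_real_character octic_character 2 3 8 by (rule primitive_octic)
  have "2 * (of_int a + of_int b * of_real (sqrt 2))
      = of_int (2 * a) + gauss_sum octic_character 8 1 * of_int b"
    unfolding gauss_sum_octic by (simp add: octic_character_def algebra_simps)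
  hence "root_sum (2 * n) (of_int (2 * a) + gauss_sum octic_character 8 1 * of_int b)"
    using root_sum_double[OF assms] by (simp only:)
  \<comment> \<open>Both coefficients are integers, so the twist applies at level 1.\<close>
  hence "root_sum (2 * n) (of_nat (totient 8) * of_int b)"
    by (rule root_sum_twist[where ?m0.0 = 1]) (rule cyclotomic_integers_of_int | simp)+
  hence "norm (of_nat (totient 8) * of_int b :: complex) \<le> real (2 * n)"
    by (rule root_sum_norm_le)
  moreover have "totient 8 = 4"
    using totient_prime_power[of 2 3] by simp
  ultimately have "real_of_int (4 * \<bar>b\<bar>) \<le> real_of_int (2 * int n)"
    by (simp add: norm_mult)
  hence "4 * \<bar>b\<bar> \<le> 2 * int n" by (simp only: of_int_le_iff)
  thus ?thesis by simp
qed

text \<open>The value \<open>c = 1\<close> must be excluded: with \<open>a = -1\<close>,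
  \<open>b = 1\<close> and \<open>n = 0\<close> the empty sum would violate the bound.\<close>

theorem theorem1p3:
  fixes a b c :: int and n :: nat and \<theta> :: "nat \<Rightarrow> complex"
  assumes "c \<ge> 0" and "squarefree c" and "c \<noteq> 1"
    and "\<And>i. i \<in> {1..n} \<Longrightarrow> root_of_unity (\<theta> i)"
    and "(\<Sum>i=1..n. \<theta> i) = complex_of_real (real_of_int a + real_of_int b * sqrt (real_of_int c))"
  shows "int n \<ge> \<bar>b\<bar> * int (totient (nat (2 * c)))"
proof -
  define C where "C = nat c"
  have c: "c = int C" using assms(1) by (simp add: C_def)
  have nz: "c \<noteq> 0" using assms(2) by auto
  have C1: "C > 1" using nz assms(3) by (auto simp: c)
  have sqf: "squarefree C"
  proof (rule squarefreeI)
    fix x assume "x ^ 2 dvd C"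
    hence "int x ^ 2 dvd c" unfolding c by (metis of_nat_dvd_iff of_nat_power)
    hence "int x dvd 1" using assms(2) squarefreeD by blast
    thus "x dvd 1" by simp
  qed
  have "(\<Sum>i<n. \<theta> (Suc i)) = of_int a + of_int b * of_real (sqrt (real C))"
    using assms(5) sum.atLeast1_atMost_eq[of \<theta> n] by (simp add: c)
  moreover have "\<forall>i<n. root_of_unity (\<theta> (Suc i))" using assms(4) by simp
  ultimately have rs: "root_sum n (of_int a + of_int b * of_real (sqrt (real C)))"
    unfolding root_sum_def by (intro exI[of _ "\<lambda>i. \<theta> (Suc i)"]) auto
  have tot: "nat (2 * c) = 2 * C" by (simp add: c nat_mult_distrib)
  show ?thesis
  proof (cases "odd C")
    \<comment> \<open>For odd \<open>C\<close> only the odd primes are needed, and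
      \<open>totient (2 * C) = totient C\<close>.\<close>
    case True
    have "root_sum n (of_nat (totient C) * of_int b)"
      using sqf True C1 cyclotomic_integers_of_int rs by (rule root_sum_cancel_sqrt)
    hence "norm (of_nat (totient C) * of_int b :: complex) \<le> real n"
      by (rule root_sum_norm_le)
    hence "real_of_int (\<bar>b\<bar> * int (totient C)) \<le> real_of_int (int n)"
      by (simp add: norm_mult mult.commute)
    hence "\<bar>b\<bar> * int (totient C) \<le> int n" by (simp only: of_int_le_iff)
    moreover have "totient (2 * C) = totient C"
      using True totient_mult_coprime[of 2 C] by simp
    ultimately show ?thesis by (simp add: tot)
  next
    case False
    \<comment> \<open>Write \<open>sqrt C\<close> as \<open>sqrt 2 * sqrt m\<close>: first cancel
      \<open>sqrt m\<close> with coefficient \<open>b * sqrt 2\<close>, then apply the bound for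
      \<open>sqrt 2\<close>.\<close>
    then obtain m where m: "C = 2 * m" by auto
    have m_odd: "odd m"
    proof
      assume "even m"
      hence "2 ^ 2 dvd C" by (auto simp: m)
      hence "(2 :: nat) dvd 1" using sqf squarefreeD by blast
      thus False by simp
    qed
    have m_sqf: "squarefree m" using sqf by (rule squarefree_mono[rotated]) (simp add: m)
    have rs2: "root_sum n (of_int a + (of_int b * of_real (sqrt 2)) * of_real (sqrt (real m)))"
      using rs by (simp add: m real_sqrt_mult mult.assoc)
    \<comment> \<open>\<open>a'\<close> is \<open>a\<close> if \<open>m = 1\<close>, where there is
      no odd prime to twist by, and 0 otherwise, since the first twist has killed
      \<open>a\<close>.\<close>
    have "\<exists>a'. root_sum n (of_int a' + of_int (int (totient m) * b) * of_real (sqrt 2))"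
    proof (cases "m = 1")
      case True
      thus ?thesis using rs2 by auto
    next
      case False
      hence m1: "m > 1" using m C1 by simp
      have "unity 8 \<in> cyclotomic_integers 8"
        by (rule cyclotomic_integers_root) (simp_all add: unity_power_self)
      hence "unity 8 + of_int (-1) * (unity 8 * (unity 8 * unity 8)) \<in> cyclotomic_integers 8"
        by (intro cyclotomic_integers_add cyclotomic_integers_mult cyclotomic_integers_of_int)
      hence "of_real (sqrt 2) \<in> cyclotomic_integers 8"
        by (simp add: sqrt_2_conv_unity_8 power3_eq_cube mult.assoc)
      hence "root_sum n (of_nat (totient m) * (of_int b * of_real (sqrt 2)))"
        using m_sqf m_odd m1 rs2
        by (intro root_sum_cancel_sqrt cyclotomic_integers_mult cyclotomic_integers_of_int)
      thus ?thesis by (intro exI[of _ 0]) (simp add: mult.assoc)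
    qed
    hence "2 * \<bar>int (totient m) * b\<bar> \<le> int n" using root_sum_sqrt_2_bound by blast
    moreover have "totient (2 * C) = 2 * totient m"
    proof -
      have "totient (2 ^ 2 * m) = totient (2 ^ 2) * totient m"
        using m_odd by (intro totient_mult_coprime) (simp only: coprime_power_left_iff, simp)
      moreover have "totient (2 ^ 2) = 2" using totient_prime_power[of 2 2] by simp
      ultimately show ?thesis by (simp add: m)
    qed
    ultimately show ?thesis unfolding tot by (simp add: abs_mult mult_ac)
  qed
qed

end
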